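(* Let $X,Y$ be compact metric spaces and let $\omega$ be a Radon measure on $X$. Let $N\ge2$, let $p_1,\dots,p_N$ be distinct points in $Y$, and let $g_1,\dots,g_N$ be positive numbers. Let $\mathcal F\subset C^+(X)$ and $\mathcal T:\mathcal F\to C_s(X,Y)$ be such that $\mathcal F$ is $\mathcal T$-convex and property (A3') (defined in the context) holds, with functions $h_{t,y_0}$, $y_0\in Y$, $\alpha_{y_0}<t<\beta_{y_0}$. Assume that $$\omega(X)=\sum_{i=1}^N g_i,$$ and that there exists $(b_1^0,\dots,b_N^0)$ with $b_i^0\in(\alpha_{p_i},\beta_{p_i})$ and $h_{b_1^0,p_1}(x)\le\min_{2\le i\le N}h_{b_i^0,p_i}(x)$ for all $x\in X$. Then there exist $b_i\in(\alpha_{p_i},\beta_{p_i})$, $2\le i\le N$, such that, with $b_1=b_1^0$, the function $$\rho(x)=\max_{1\le i\le N}h_{b_i,p_i}(x)$$ satisfies $$M_{\mathcal T(\rho)}=\sum_{i=1}^N g_i\,\delta_{p_i}.$$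
   Context: Let $X,Y$ be compact metric spaces and $\omega$ a Radon measure on $X$ (nonnegative, finite, completed). A set-valued map $\Phi$ from $X$ to $Y$ assigns to each $x\in X$ a nonempty subset $\Phi(x)\subset Y$. $Y^X$ denotes the class of set-valued maps $\Phi$ from $X$ to $Y$ such that $\Phi(x)$ is a singleton for $\omega$-a.e. $x$. A map $\Phi\in Y^X$ is continuous at $x_0\in X$ if, whenever $x_k\to x_0$ and $y_k\in\Phi(x_k)$, there are a subsequence $y_{k_j}$ and $y_0\in\Phi(x_0)$ with $y_{k_j}\to y_0$. $C(X,Y)$ is the class of $\Phi\in Y^X$ continuous at every point of $X$, and $C_s(X,Y)$ is the class of $\Phi\in C(X,Y)$ with $\Phi(X)=\bigcup_{x\in X}\Phi(x)=Y$. For $\Phi\in C_s(X,Y)$ and $E\subset Y$, $\Phi^{-1}(E)=\{x\in X:\Phi(x)\cap E\ne\emptyset\}$, and $M_\Phi(E)=\omega(\Phi^{-1}(E))$, which is a Radon measure on $Y$. $C(X)$ is the set of real continuous functions on $X$ with the topology of uniform convergence; $C^+(X)$ is the set of continuous positive functions on $X$. A map $\mathcal T:\mathcal F\to C_s(X,Y)$, $\mathcal F\subset C(X)$, is continuous at $\phi\in\mathcal F$ if whenever $\phi_j\in\mathcal F$, $\phi_j\to\phi$ uniformly in $X$, $x_0\in X$ and $y_j\in\mathcal T(\phi_j)(x_0)$, there is a subsequence $y_{j_\ell}$ converging to some $y_0\in\mathcal T(\phi)(x_0)$. A class $\mathcal F\subset C^+(X)$ is $\mathcal T$-convex if: (A1')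 $f_1,f_2\in\mathcal F$ implies $f_1\vee f_2=\max\{f_1,f_2\}\in\mathcal F$; and $\mathcal T:\mathcal F\to C_s(X,Y)$ is a map that is continuous at each $\phi\in\mathcal F$ and satisfies (A2'): if $\phi_1,\phi_2\in\mathcal F$ and $\phi_1(x_0)\ge\phi_2(x_0)$, then $\mathcal T(\phi_1)(x_0)\subset\mathcal T(\phi_1\vee\phi_2)(x_0)$. Property (A3'): for each $y_0\in Y$ there exist an interval $(\alpha_{y_0},\beta_{y_0})$ (endpoints possibly infinite) and a family $\{h_{t,y_0}\}_{\alpha_{y_0}<t<\beta_{y_0}}\subset\mathcal F$ such that (a) $y_0\in\mathcal T(h_{t,y_0})(x)$ for all $x\in X$; (b) $h_{t,y_0}\ge h_{s,y_0}$ for $t\le s$; (c) $h_{t,y_0}\to 0$ uniformly as $t\to\beta_{y_0}$; (d) $\max_{x\in X}|h_{t',y_0}(x)-h_{t,y_0}(x)|\to 0$ as $t'\to t$, for $\alpha_{y_0}<t<\beta_{y_0}$. *)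

theory Defs
  imports "HOL-Analysis.Analysis"
begin

text \<open>
  The compact metric spaces \<open>X\<close> and \<open>Y\<close> are the universes of types \<open>'a\<close> and \<open>'b\<close> of class
  \<^class>\<open>metric_space\<close>; theorems assume \<open>compact (UNIV :: 'a set)\<close> and
  \<open>compact (UNIV :: 'b set)\<close>. Set-valued maps are functions \<open>'a \<Rightarrow> 'b set\<close>.
\<close>

text \<open>
  The completion of a finite Borel measure that is inner regular with respect to compact sets
  (finiteness makes outer regularity a consequence).
\<close>

definition radon_measure :: "'a::metric_space measure \<Rightarrow> bool" where
  "radon_measure \<omega> \<longleftrightarrow>
     (\<exists>\<mu>. sets \<mu> = sets borel \<and> finite_measure \<mu> \<and>
          (\<forall>B\<in>sets borel. emeasure \<mu> B = (SUP K\<in>{K. K \<subseteq> B \<and> compact K}. emeasure \<mu> K)) \<and>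
          \<omega> = completion \<mu>)"

definition setvalued_maps :: "'a measure \<Rightarrow> ('a \<Rightarrow> 'b set) set" where
  "setvalued_maps \<omega> = {\<Phi>. (\<forall>x. \<Phi> x \<noteq> {}) \<and> (AE x in \<omega>. is_singleton (\<Phi> x))}"

definition sv_continuous_at :: "('a::metric_space \<Rightarrow> 'b::metric_space set) \<Rightarrow> 'a \<Rightarrow> bool" where
  "sv_continuous_at \<Phi> x0 \<longleftrightarrow>
     (\<forall>x y. x \<longlonglongrightarrow> x0 \<and> (\<forall>k::nat. y k \<in> \<Phi> (x k)) \<longrightarrow>
        (\<exists>r y0. strict_mono r \<and> y0 \<in> \<Phi> x0 \<and> (y \<circ> r) \<longlonglongrightarrow> y0))"

definition C_maps :: "'a::metric_space measure \<Rightarrow> ('a \<Rightarrow> 'b::metric_space set) set" where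
  "C_maps \<omega> = {\<Phi> \<in> setvalued_maps \<omega>. \<forall>x0. sv_continuous_at \<Phi> x0}"

definition Cs_maps :: "'a::metric_space measure \<Rightarrow> ('a \<Rightarrow> 'b::metric_space set) set" where
  "Cs_maps \<omega> = {\<Phi> \<in> C_maps \<omega>. (\<Union>x. \<Phi> x) = UNIV}"

definition sv_preimage :: "('a \<Rightarrow> 'b set) \<Rightarrow> 'b set \<Rightarrow> 'a set" where
  "sv_preimage \<Phi> E = {x. \<Phi> x \<inter> E \<noteq> {}}"

text \<open>
  \<open>M\<^sub>\<Phi>\<close> as a Borel measure on \<open>Y\<close>. For \<open>\<Phi> \<in> Cs_maps \<omega>\<close> the junk values of \<^const>\<open>measure_of\<close> and
  \<^const>\<open>emeasure\<close> do not occur: see \<open>sv_preimage_borel\<close> and \<open>emeasure_induced_measure\<close> below.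
\<close>

definition induced_measure ::
    "'a::metric_space measure \<Rightarrow> ('a \<Rightarrow> 'b::metric_space set) \<Rightarrow> 'b measure" where
  "induced_measure \<omega> \<Phi> =
     measure_of UNIV (sets borel) (\<lambda>E. emeasure \<omega> (sv_preimage \<Phi> E))"

text \<open>The Borel measure \<open>\<Sum>i\<in>I. g i \<delta>\<^bsub>p i\<^esub>\<close>.\<close>

definition dirac_sum ::
    "'i set \<Rightarrow> ('i \<Rightarrow> real) \<Rightarrow> ('i \<Rightarrow> 'b::metric_space) \<Rightarrow> 'b measure" where
  "dirac_sum I g p =
     measure_of UNIV (sets borel) (\<lambda>E. \<Sum>i\<in>I. ennreal (g i) * indicator E (p i))"

definition C_plus :: "('a::metric_space \<Rightarrow> real) set" where
  "C_plus = {f. continuous_on UNIV f \<and> (\<forall>x. f x > 0)}"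

definition operator_continuous_at ::
    "('a::metric_space \<Rightarrow> real) set \<Rightarrow> (('a \<Rightarrow> real) \<Rightarrow> 'a \<Rightarrow> 'b::metric_space set) \<Rightarrow>
     ('a \<Rightarrow> real) \<Rightarrow> bool" where
  "operator_continuous_at \<F> T \<phi> \<longleftrightarrow>
     (\<forall>f x0 y. (\<forall>j::nat. f j \<in> \<F>) \<and> uniform_limit UNIV f \<phi> sequentially \<and>
               (\<forall>j. y j \<in> T (f j) x0) \<longrightarrow>
        (\<exists>r y0. strict_mono r \<and> y0 \<in> T \<phi> x0 \<and> (y \<circ> r) \<longlonglongrightarrow> y0))"

definition T_convex ::
    "'a::metric_space measure \<Rightarrow> ('a \<Rightarrow> real) set \<Rightarrow>
     (('a \<Rightarrow> real) \<Rightarrow> 'a \<Rightarrow> 'b::metric_space set) \<Rightarrow> bool" where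
  "T_convex \<omega> \<F> T \<longleftrightarrow>
     \<F> \<subseteq> C_plus \<and>
     (\<forall>f1\<in>\<F>. \<forall>f2\<in>\<F>. (\<lambda>x. max (f1 x) (f2 x)) \<in> \<F>) \<and>
     (\<forall>\<phi>\<in>\<F>. T \<phi> \<in> Cs_maps \<omega>) \<and>
     (\<forall>\<phi>\<in>\<F>. operator_continuous_at \<F> T \<phi>) \<and>
     (\<forall>\<phi>1\<in>\<F>. \<forall>\<phi>2\<in>\<F>. \<forall>x0. \<phi>1 x0 \<ge> \<phi>2 x0 \<longrightarrow>
        T \<phi>1 x0 \<subseteq> T (\<lambda>x. max (\<phi>1 x) (\<phi>2 x)) x0)"

definition ereal_interval :: "ereal \<Rightarrow> ereal \<Rightarrow> real set" where
  "ereal_interval a b = {t. a < ereal t \<and> ereal t < b}"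

text \<open>
  Values of \<open>h t y\<close> for \<open>t\<close> outside \<open>(\<alpha> y, \<beta> y)\<close> are irrelevant. The filter
  \<open>filtercomap ereal (at_left (\<beta> y))\<close> is \<^term>\<open>at_left b\<close> on the reals if \<open>\<beta> y = ereal b\<close> and
  \<^const>\<open>at_top\<close> if \<open>\<beta> y = \<infinity>\<close>. For \<open>t'\<close> in the interval the supremum is a maximum, by
  compactness of \<open>X\<close>.
\<close>

definition property_A3 ::
    "('a::metric_space \<Rightarrow> real) set \<Rightarrow> (('a \<Rightarrow> real) \<Rightarrow> 'a \<Rightarrow> 'b::metric_space set) \<Rightarrow>
     ('b \<Rightarrow> ereal) \<Rightarrow> ('b \<Rightarrow> ereal) \<Rightarrow> (real \<Rightarrow> 'b \<Rightarrow> 'a \<Rightarrow> real) \<Rightarrow> bool" where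
  "property_A3 \<F> T \<alpha> \<beta> h \<longleftrightarrow>
     (\<forall>y. \<alpha> y < \<beta> y \<and>
       (\<forall>t\<in>ereal_interval (\<alpha> y) (\<beta> y). h t y \<in> \<F>) \<and>
       (\<forall>t\<in>ereal_interval (\<alpha> y) (\<beta> y). \<forall>x. y \<in> T (h t y) x) \<and>
       (\<forall>s\<in>ereal_interval (\<alpha> y) (\<beta> y). \<forall>t\<in>ereal_interval (\<alpha> y) (\<beta> y).
          t \<le> s \<longrightarrow> (\<forall>x. h t y x \<ge> h s y x)) \<and>
       uniform_limit UNIV (\<lambda>t. h t y) (\<lambda>_. 0) (filtercomap ereal (at_left (\<beta> y))) \<and>
       (\<forall>t\<in>ereal_interval (\<alpha> y) (\<beta> y).
          ((\<lambda>t'. SUP x. \<bar>h t' y x - h t y x\<bar>) \<longlongrightarrow> 0) (at t)))"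

lemma radon_measure_facts:
  assumes "radon_measure \<omega>"
  shows "sets borel \<subseteq> sets \<omega>" "space \<omega> = UNIV" "finite_measure \<omega>" "complete_measure \<omega>"
proof -
  obtain \<mu> where \<mu>: "sets \<mu> = sets borel" "finite_measure \<mu>" "\<omega> = completion \<mu>"
    using assms unfolding radon_measure_def by blast
  show "sets borel \<subseteq> sets \<omega>"
    using \<mu> by auto
  show "space \<omega> = UNIV"
    using \<mu> sets_eq_imp_space_eq[of \<mu> borel] by simp
  show "complete_measure \<omega>"
    using \<mu>(3) completion.complete_measure_axioms by simp
  show "finite_measure \<omega>"
    using \<mu> by (auto intro!: finite_measureI simp: finite_measure.emeasure_finite)
qed

lemma sv_preimage_closed:
  assumes \<Phi>: "\<And>x0. sv_continuous_at \<Phi> x0" and C: "closed C"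
  shows "closed (sv_preimage \<Phi> C)"
  unfolding closed_sequential_limits
proof (intro allI impI, elim conjE)
  fix x l assume x: "\<forall>n. x n \<in> sv_preimage \<Phi> C" and lim: "x \<longlonglongrightarrow> l"
  have "\<forall>n. \<exists>y. y \<in> \<Phi> (x n) \<and> y \<in> C"
    using x by (auto simp: sv_preimage_def)
  then obtain y where y: "\<And>n. y n \<in> \<Phi> (x n)" "\<And>n. y n \<in> C"
    by metis
  obtain r y0 where r: "y0 \<in> \<Phi> l" "(y \<circ> r) \<longlonglongrightarrow> y0"
    using \<Phi>[of l] lim y(1) unfolding sv_continuous_at_def by blast
  have "y0 \<in> C"
    using closed_sequentially[OF C _ r(2)] y(2) by simp
  with r(1) show "l \<in> sv_preimage \<Phi> C"
    by (auto simp: sv_preimage_def)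
qed

lemma Cs_maps_null:
  assumes \<omega>: "radon_measure \<omega>" and \<Phi>: "\<Phi> \<in> Cs_maps \<omega>"
  shows "{x. \<not> is_singleton (\<Phi> x)} \<in> null_sets \<omega>"
proof -
  interpret complete_measure \<omega> using radon_measure_facts[OF \<omega>] by simp
  show ?thesis
    using \<Phi> AE_iff_null_sets[of "\<lambda>x. is_singleton (\<Phi> x)"] radon_measure_facts(2)[OF \<omega>]
    by (simp add: Cs_maps_def C_maps_def setvalued_maps_def)
qed

lemma sv_preimage_borel:
  assumes \<omega>: "radon_measure \<omega>" and \<Phi>: "\<Phi> \<in> Cs_maps \<omega>" and E: "E \<in> sets borel"
  shows "sv_preimage \<Phi> E \<in> sets \<omega>"
proof -
  interpret complete_measure \<omega> using radon_measure_facts[OF \<omega>] by simp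
  note null = Cs_maps_null[OF \<omega> \<Phi>]
  have ne: "\<And>x. \<Phi> x \<noteq> {}" and cont: "\<And>x0. sv_continuous_at \<Phi> x0"
    using \<Phi> by (auto simp: Cs_maps_def C_maps_def setvalued_maps_def)
  have "E \<in> sigma_sets UNIV (Collect closed)"
    using E by (simp add: borel_eq_closed)
  then show ?thesis
  proof induction
    case (Basic a)
    then have "closed (sv_preimage \<Phi> a)"
      using cont sv_preimage_closed by blast
    then show ?case
      using radon_measure_facts(1)[OF \<omega>] borel_closed by blast
  next
    case Empty
    then show ?case by (simp add: sv_preimage_def)
  next
    case (Compl a)
    let ?R = "sv_preimage \<Phi> (UNIV - a) \<inter> sv_preimage \<Phi> a"
    have "?R \<subseteq> {x. \<not> is_singleton (\<Phi> x)}"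
      by (auto simp: sv_preimage_def is_singleton_def)
    then have "?R \<in> sets \<omega>"
      using complete null by blast
    moreover have "sv_preimage \<Phi> (UNIV - a) = (space \<omega> - sv_preimage \<Phi> a) \<union> ?R"
      using ne radon_measure_facts(2)[OF \<omega>] by (auto simp: sv_preimage_def)
    ultimately show ?case
      using Compl.IH by (metis sets.Un sets.compl_sets)
  next
    case (Union a)
    have "sv_preimage \<Phi> (\<Union>(range a)) = (\<Union>i. sv_preimage \<Phi> (a i))"
      by (auto simp: sv_preimage_def)
    then show ?case
      using Union.IH by auto
  qed
qed

lemma sets_induced_measure [simp]: "sets (induced_measure \<omega> \<Phi>) = sets borel"
  unfolding induced_measure_def using sets.sigma_sets_eq[of borel] by (simp add: sets_measure_of)

lemma emeasure_induced_measure: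
  assumes \<omega>: "radon_measure \<omega>" and \<Phi>: "\<Phi> \<in> Cs_maps \<omega>" and E: "E \<in> sets borel"
  shows "emeasure (induced_measure \<omega> \<Phi>) E = emeasure \<omega> (sv_preimage \<Phi> E)"
proof (rule emeasure_measure_of[OF induced_measure_def])
  let ?N = "{x. \<not> is_singleton (\<Phi> x)}"
  note null = Cs_maps_null[OF \<omega> \<Phi>]
  note meas = sv_preimage_borel[OF \<omega> \<Phi>]
  show "sets borel \<subseteq> Pow UNIV" by simp
  show "E \<in> sets (induced_measure \<omega> \<Phi>)" using E by simp
  show "positive (sets (induced_measure \<omega> \<Phi>)) (\<lambda>E. emeasure \<omega> (sv_preimage \<Phi> E))"
    by (simp add: positive_def sv_preimage_def)
  show "countably_additive (sets (induced_measure \<omega> \<Phi>)) (\<lambda>E. emeasure \<omega> (sv_preimage \<Phi> E))"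
  proof (rule countably_additiveI)
    fix A :: "nat \<Rightarrow> 'b set"
    assume A: "range A \<subseteq> sets (induced_measure \<omega> \<Phi>)" "disjoint_family A"
    have Ai: "sv_preimage \<Phi> (A i) \<in> sets \<omega>" for i
      using A(1) by (intro meas) auto
    have U: "sv_preimage \<Phi> (\<Union>(range A)) = (\<Union>i. sv_preimage \<Phi> (A i))"
      by (auto simp: sv_preimage_def)
    have disj: "disjoint_family (\<lambda>i. sv_preimage \<Phi> (A i) - ?N)"
      using A(2) by (auto simp: disjoint_family_on_def sv_preimage_def is_singleton_def) blast
    have "(\<Sum>i. emeasure \<omega> (sv_preimage \<Phi> (A i)))
        = (\<Sum>i. emeasure \<omega> (sv_preimage \<Phi> (A i) - ?N))"
      using emeasure_Diff_null_set[OF null Ai] by simp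
    also have "\<dots> = emeasure \<omega> (\<Union>i. sv_preimage \<Phi> (A i) - ?N)"
      using Ai null by (intro suminf_emeasure disj) auto
    also have "(\<Union>i. sv_preimage \<Phi> (A i) - ?N) = (\<Union>i. sv_preimage \<Phi> (A i)) - ?N"
      by auto
    also have "emeasure \<omega> \<dots> = emeasure \<omega> (\<Union>i. sv_preimage \<Phi> (A i))"
      using Ai by (intro emeasure_Diff_null_set[OF null]) auto
    finally show "(\<Sum>i. emeasure \<omega> (sv_preimage \<Phi> (A i)))
        = emeasure \<omega> (sv_preimage \<Phi> (\<Union>(range A)))"
      by (simp add: U)
  qed
qed

lemma sets_dirac_sum [simp]: "sets (dirac_sum I g p) = sets borel"
  unfolding dirac_sum_def using sets.sigma_sets_eq[of borel] by (simp add: sets_measure_of)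

lemma emeasure_dirac_sum:
  fixes p :: "'i \<Rightarrow> 'b::metric_space"
  assumes E: "E \<in> sets borel"
  shows "emeasure (dirac_sum I g p) E = (\<Sum>i\<in>I. ennreal (g i) * indicator E (p i))"
proof (rule emeasure_measure_of[OF dirac_sum_def])
  show "sets borel \<subseteq> Pow UNIV" by simp
  show "E \<in> sets (dirac_sum I g p)" using E by simp
  show "positive (sets (dirac_sum I g p)) (\<lambda>E. \<Sum>i\<in>I. ennreal (g i) * indicator E (p i))"
    by (simp add: positive_def)
  show "countably_additive (sets (dirac_sum I g p))
          (\<lambda>E. \<Sum>i\<in>I. ennreal (g i) * indicator E (p i))"
  proof (rule countably_additiveI)
    fix A :: "nat \<Rightarrow> 'b set"
    assume A: "disjoint_family A"
    have "(\<Sum>n. \<Sum>i\<in>I. ennreal (g i) * indicator (A n) (p i))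
        = (\<Sum>i\<in>I. \<Sum>n. ennreal (g i) * indicator (A n) (p i))"
      by (intro suminf_sum) auto
    also have "\<dots> = (\<Sum>i\<in>I. ennreal (g i) * indicator (\<Union>(range A)) (p i))"
      by (simp add: suminf_indicator[OF A])
    finally show "(\<Sum>n. \<Sum>i\<in>I. ennreal (g i) * indicator (A n) (p i))
        = (\<Sum>i\<in>I. ennreal (g i) * indicator (\<Union>(range A)) (p i))" .
  qed
qed

end

theory Submission
  imports Defs
begin

text \<open>
  Write \<open>\<rho>\<^sub>b\<close> for the maximum of the functions \<open>h (b i) (p i)\<close> and \<open>G\<^sub>i(b)\<close> for the mass that
  \<open>T \<rho>\<^sub>b\<close> sends to \<open>p i\<close>. At every point \<open>\<rho>\<^sub>b\<close> agrees with one of these functions, so by the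
  convexity axiom the image of each point contains some \<open>p i\<close>. Since the images are almost surely
  singletons, the induced measure is \<open>\<Sum>i. G\<^sub>i(b) \<delta>\<^bsub>p i\<^esub>\<close> with total mass \<open>\<omega>(X)\<close>
  (\<open>induced_measure_eq_dirac_sum\<close>). The problem is thus to solve \<open>G\<^sub>i(b) = g i\<close> for \<open>i \<ge> 2\<close>; the
  equation for \<open>i = 1\<close> then follows from the balance of masses.

  Two properties of \<open>G\<close> make this system solvable. It is continuous, because both \<open>h\<close> and \<open>T\<close> are
  (\<open>A3_uniform_limit\<close>, \<open>measure_preimage_tendsto\<close>). And lowering \<open>b k\<close> raises \<open>h (b k) (p k)\<close>,
  so that no other target can gain mass (\<open>measure_preimage_max_le\<close>).

  Consider then the vectors \<open>b\<close> with \<open>G\<^sub>i(b) \<le> g i\<close> for \<open>i \<ge> 2\<close>. There is one: when all \<open>b i\<close> with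
  \<open>i \<ge> 2\<close> are close to the upper endpoints, \<open>h (b0 1) (p 1)\<close> dominates and all mass goes to \<open>p 1\<close>.
  Such vectors stay away from the lower bounds \<open>b0 i\<close>: if \<open>b i = b0 i\<close> for some \<open>i \<ge> 2\<close>, the
  first function never exceeds the \<open>i\<close>-th, so the targets \<open>p 2, \<dots>, p N\<close> receive the whole mass,
  and that is more than \<open>\<Sum>i\<ge>2. g i\<close>. Minimise \<open>\<Sum>i\<ge>2. b i\<close> among these vectors, in a compact box
  with lower corner \<open>b0\<close>. At the minimiser every inequality is an equality: otherwise one could
  lower the coordinate in question a little further (\<open>antitone_system_solution\<close>).
\<close>

section \<open>A monotone system of equations\<close>

text \<open>
  The solution is a minimiser of \<open>\<Sum>i\<in>J. b i\<close> over the vectors of the box with \<open>G b i \<le> g i\<close>.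
  If \<open>G b k < g k\<close> there, then lowering the \<open>k\<close>-th coordinate slightly keeps that inequality by
  continuity and the others by \<open>mono\<close>, while \<open>interior\<close> leaves the room to do so.
\<close>

lemma antitone_system_solution:
  fixes G :: "('i::countable \<Rightarrow> real) \<Rightarrow> 'i \<Rightarrow> real" and a c :: "'i \<Rightarrow> real"
  defines "B \<equiv> {b. \<forall>i. a i \<le> b i \<and> b i \<le> c i}"
  assumes J: "finite J"
    and cont: "\<And>i. i \<in> J \<Longrightarrow> continuous_on B (\<lambda>b. G b i)"
    and mono: "\<And>b k i t. b \<in> B \<Longrightarrow> k \<in> J \<Longrightarrow> i \<in> J \<Longrightarrow> i \<noteq> k \<Longrightarrow> a k \<le> t \<Longrightarrow> t \<le> b k \<Longrightarrow>
                 G (b(k := t)) i \<le> G b i"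
    and start: "\<And>i. a i \<le> c i" "\<And>i. i \<in> J \<Longrightarrow> G c i \<le> g i"
    and interior: "\<And>b i. b \<in> B \<Longrightarrow> (\<And>j. j \<in> J \<Longrightarrow> G b j \<le> g j) \<Longrightarrow> i \<in> J \<Longrightarrow> b i \<noteq> a i"
  obtains b where "b \<in> B" "\<And>i. i \<in> J \<Longrightarrow> G b i = g i"
proof -
  have B_eq: "B = (\<Pi>\<^sub>E i\<in>UNIV. {a i..c i})"
    by (auto simp: B_def PiE_def extensional_def)
  have compB: "compact B"
    unfolding B_eq using compactin_PiE[of "\<lambda>i. euclidean" UNIV "\<lambda>i. {a i..c i}"]
    by (simp add: euclidean_product_topology)
  define W where "W = {b\<in>B. \<forall>i\<in>J. G b i \<le> g i}"
  have W_eq: "W = B \<inter> (\<Inter>i\<in>J. {b\<in>B. G b i \<le> g i})"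
    by (auto simp: W_def)
  have "closed {b\<in>B. G b i \<le> g i}" if "i \<in> J" for i
    using continuous_on_closed_Collect_le[OF cont[OF that] continuous_on_const
        compact_imp_closed[OF compB]] .
  then have "compact W"
    unfolding W_eq by (intro compact_Int_closed compB closed_INT ballI)
  moreover have "c \<in> W"
    using start by (auto simp: W_def B_def)
  moreover have "continuous_on W (\<lambda>b. \<Sum>i\<in>J. b i)"
    by (intro continuous_on_sum continuous_on_subset[OF continuous_on_product_coordinates]) auto
  ultimately obtain b where b: "b \<in> W" and least: "\<And>b'. b' \<in> W \<Longrightarrow> (\<Sum>i\<in>J. b i) \<le> (\<Sum>i\<in>J. b' i)"
    using continuous_attains_inf[of W "\<lambda>b. \<Sum>i\<in>J. b i"] by blast
  have "G b k = g k" if k: "k \<in> J" for k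
  proof (rule ccontr)
    assume "G b k \<noteq> g k"
    then have lt: "G b k < g k"
      using b k by (force simp: W_def)
    have "b k \<noteq> a k"
      using interior[of b k] b k by (auto simp: W_def)
    moreover have "a k \<le> b k"
      using b by (simp add: W_def B_def)
    ultimately have ak: "a k < b k"
      by simp
    define u where "u = (\<lambda>t. b(k := t))"
    have uB: "u t \<in> B" if "t \<in> {a k..b k}" for t
      using that b unfolding W_def B_def u_def by (auto intro: order_trans)
    have "continuous_on UNIV u"
    proof (rule continuous_on_coordinatewise_then_product)
      show "continuous_on UNIV (\<lambda>t. u t i)" for i
        by (cases "i = k") (auto simp: u_def)
    qed
    then have "continuous_on {a k..b k} (\<lambda>t. G (u t) k)"
      by (rule continuous_on_compose2[OF cont[OF k] continuous_on_subset])
         (use uB in auto)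
    then have "((\<lambda>t. G (u t) k) \<longlongrightarrow> G (u (b k)) k) (at (b k) within {a k..b k})"
      using ak by (auto simp: continuous_on_def)
    then have "\<forall>\<^sub>F t in at_left (b k). G (u t) k < g k"
      using lt ak by (simp add: u_def order_tendsto_iff at_within_Icc_at_left)
    then have "\<forall>\<^sub>F t in at_left (b k). G (u t) k < g k \<and> t \<in> {a k<..<b k}"
      using eventually_at_left_real[OF ak] by (rule eventually_conj)
    then obtain t where t: "G (u t) k < g k" "a k < t" "t < b k"
      using eventually_happens'[OF trivial_limit_at_left_real] by fastforce
    have "G (u t) i \<le> g i" if "i \<in> J" for i
    proof (cases "i = k")
      case False
      then have "G (u t) i \<le> G b i"
        using mono[of b k i t] b t k that by (simp add: W_def u_def)
      also have "\<dots> \<le> g i"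
        using b that by (simp add: W_def)
      finally show ?thesis .
    qed (use t in simp)
    then have "u t \<in> W"
      using uB[of t] t by (auto simp: W_def)
    then have "(\<Sum>i\<in>J. b i) \<le> (\<Sum>i\<in>J. u t i)"
      by (rule least)
    moreover have "(\<Sum>i\<in>J. u t i) < (\<Sum>i\<in>J. b i)"
      using t k J by (intro sum_strict_mono_ex1) (auto simp: u_def)
    ultimately show False
      by simp
  qed
  then show thesis
    using b that by (auto simp: W_def)
qed

section \<open>Finite maxima\<close>

lemma uniform_limit_max:
  fixes f f' :: "'n \<Rightarrow> 'a \<Rightarrow> real"
  assumes "uniform_limit S f l F" "uniform_limit S f' l' F"
  shows "uniform_limit S (\<lambda>n x. max (f n x) (f' n x)) (\<lambda>x. max (l x) (l' x)) F"
proof (rule uniform_limitI)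
  fix e :: real assume "e > 0"
  then have "\<forall>\<^sub>F n in F. (\<forall>x\<in>S. dist (f n x) (l x) < e) \<and> (\<forall>x\<in>S. dist (f' n x) (l' x) < e)"
    using assms by (intro eventually_conj uniform_limitD)
  then show "\<forall>\<^sub>F n in F. \<forall>x\<in>S. dist (max (f n x) (f' n x)) (max (l x) (l' x)) < e"
    by eventually_elim (fastforce simp: dist_real_def max_def abs_if split: if_splits)
qed

lemma uniform_limit_Max:
  fixes f :: "'i \<Rightarrow> 'n \<Rightarrow> 'a \<Rightarrow> real"
  assumes "finite I" "I \<noteq> {}" "\<And>i. i \<in> I \<Longrightarrow> uniform_limit S (f i) (l i) F"
  shows "uniform_limit S (\<lambda>n x. MAX i\<in>I. f i n x) (\<lambda>x. MAX i\<in>I. l i x) F"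
  using assms by (induction rule: finite_ne_induct) (simp_all add: uniform_limit_max)

lemma T_convex_Max_closed:
  assumes T: "T_convex \<omega> \<F> T" and "finite I" "I \<noteq> {}" "\<And>i. i \<in> I \<Longrightarrow> f i \<in> \<F>"
  shows "(\<lambda>x. MAX i\<in>I. f i x) \<in> \<F>"
  using assms(2-4)
proof (induction rule: finite_ne_induct)
  case (insert i I)
  then show ?case
    using T by (simp add: T_convex_def)
qed simp

lemma T_convex_image_subset:
  assumes T: "T_convex \<omega> \<F> T" and "\<phi> \<in> \<F>" "\<psi> \<in> \<F>" "\<And>z. \<phi> z \<le> \<psi> z" "\<phi> x = \<psi> x"
  shows "T \<phi> x \<subseteq> T \<psi> x"
proof -
  have "\<psi> x \<le> \<phi> x"
    using assms(5) by simp
  then have "T \<phi> x \<subseteq> T (\<lambda>z. max (\<phi> z) (\<psi> z)) x"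
    using T assms(2,3) unfolding T_convex_def by blast
  also have "(\<lambda>z. max (\<phi> z) (\<psi> z)) = \<psi>"
    using assms(4) by (simp add: max_def)
  finally show ?thesis .
qed

section \<open>Induced measures concentrated on finitely many points\<close>

lemma AE_Cs_maps_unique:
  assumes "\<Phi> \<in> Cs_maps \<omega>"
  shows "AE x in \<omega>. \<forall>y\<in>\<Phi> x. \<forall>z\<in>\<Phi> x. y = z"
proof -
  have "AE x in \<omega>. is_singleton (\<Phi> x)"
    using assms by (simp add: Cs_maps_def C_maps_def setvalued_maps_def)
  then show ?thesis
    by eventually_elim (auto simp: is_singleton_def)
qed

text \<open>
  A point whose image leaves the finite set \<open>p ` I\<close> has at least two image points, because it also
  meets that set; hence the complement of \<open>p ` I\<close> carries no mass.
\<close>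

lemma induced_measure_eq_dirac_sum:
  assumes \<omega>: "radon_measure \<omega>" and \<Phi>: "\<Phi> \<in> Cs_maps \<omega>"
    and I: "finite I" "inj_on p I" and cov: "\<And>x. \<exists>i\<in>I. p i \<in> \<Phi> x"
  shows "induced_measure \<omega> \<Phi> = dirac_sum I (\<lambda>i. measure \<omega> (sv_preimage \<Phi> {p i})) p"
proof (rule measure_eqI)
  interpret finite_measure \<omega> using radon_measure_facts[OF \<omega>] by simp
  let ?M = "induced_measure \<omega> \<Phi>"
  fix E assume "E \<in> sets ?M"
  then have E: "E \<in> sets borel" by simp
  have pI: "p ` I \<in> sets borel"
    using I by (intro borel_closed finite_imp_closed) auto
  have "\<not> is_singleton (\<Phi> x)" if "x \<in> sv_preimage \<Phi> (- (p ` I))" for x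
  proof -
    obtain i where "i \<in> I" "p i \<in> \<Phi> x"
      using cov by blast
    then show ?thesis
      using that by (auto simp: sv_preimage_def is_singleton_def)
  qed
  then have "sv_preimage \<Phi> (- (p ` I)) \<subseteq> {x. \<not> is_singleton (\<Phi> x)}"
    by blast
  then have "sv_preimage \<Phi> (- (p ` I)) \<in> null_sets \<omega>"
    using Cs_maps_null[OF \<omega> \<Phi>] sv_preimage_borel[OF \<omega> \<Phi>] pI
    by (meson null_sets_subset sets.compl_sets borel_comp)
  then have null: "- (p ` I) \<in> null_sets ?M"
    using pI emeasure_induced_measure[OF \<omega> \<Phi>, of "- (p ` I)"] by (auto simp: null_sets_def)
  have "emeasure ?M E = emeasure ?M (E - - (p ` I))"
    using E emeasure_Diff_null_set[OF null, of E] by simp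
  also have "E - - (p ` I) = p ` {i\<in>I. p i \<in> E}"
    by auto
  also have "emeasure ?M \<dots> = (\<Sum>y\<in>p ` {i\<in>I. p i \<in> E}. emeasure ?M {y})"
    using I by (intro emeasure_eq_sum_singleton) auto
  also have "\<dots> = (\<Sum>i | i \<in> I \<and> p i \<in> E. emeasure ?M {p i})"
    using I by (subst sum.reindex) (auto intro: inj_on_subset)
  also have "\<dots> = (\<Sum>i\<in>I. ennreal (measure \<omega> (sv_preimage \<Phi> {p i})) * indicator E (p i))"
    using I by (intro sum.mono_neutral_cong_left)
      (auto simp: emeasure_induced_measure[OF \<omega> \<Phi>] emeasure_eq_measure)
  finally show "emeasure ?M E =
      emeasure (dirac_sum I (\<lambda>i. measure \<omega> (sv_preimage \<Phi> {p i})) p) E"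
    by (simp add: emeasure_dirac_sum[OF E])
qed simp

lemma sum_measure_preimage:
  assumes \<omega>: "radon_measure \<omega>" and \<Phi>: "\<Phi> \<in> Cs_maps \<omega>"
    and I: "finite I" "inj_on p I" and cov: "\<And>x. \<exists>i\<in>I. p i \<in> \<Phi> x"
  shows "(\<Sum>i\<in>I. measure \<omega> (sv_preimage \<Phi> {p i})) = measure \<omega> UNIV"
proof -
  interpret finite_measure \<omega> using radon_measure_facts[OF \<omega>] by simp
  have "sv_preimage \<Phi> UNIV = UNIV"
    using cov by (auto simp: sv_preimage_def)
  then have "emeasure \<omega> UNIV = emeasure (induced_measure \<omega> \<Phi>) UNIV"
    by (simp add: emeasure_induced_measure[OF \<omega> \<Phi>])
  also have "\<dots> = ennreal (\<Sum>i\<in>I. measure \<omega> (sv_preimage \<Phi> {p i}))"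
    by (simp add: induced_measure_eq_dirac_sum[OF assms] emeasure_dirac_sum sum_ennreal)
  finally show ?thesis
    by (simp add: emeasure_eq_measure sum_nonneg)
qed

section \<open>Monotonicity and continuity of the masses\<close>

text \<open>
  Where \<open>\<psi> \<ge> \<phi>\<close>, the image under the maximum contains \<open>q\<close>, so almost surely not \<open>y\<close>. Elsewhere
  \<open>T \<phi> x\<close> is contained in that image, so almost surely it is \<open>{y}\<close> whenever the image contains \<open>y\<close>.
\<close>

lemma measure_preimage_max_le:
  assumes \<omega>: "radon_measure \<omega>" and T: "T_convex \<omega> \<F> T"
    and \<phi>: "\<phi> \<in> \<F>" and \<psi>: "\<psi> \<in> \<F>" and q: "\<And>x. q \<in> T \<psi> x" "y \<noteq> q"
  shows "measure \<omega> (sv_preimage (T (\<lambda>x. max (\<phi> x) (\<psi> x))) {y})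
           \<le> measure \<omega> (sv_preimage (T \<phi>) {y})"
proof -
  interpret finite_measure \<omega> using radon_measure_facts[OF \<omega>] by simp
  let ?m = "\<lambda>x. max (\<phi> x) (\<psi> x)"
  have m: "?m \<in> \<F>" and Cs: "T \<phi> \<in> Cs_maps \<omega>" "T ?m \<in> Cs_maps \<omega>"
    using T \<phi> \<psi> by (auto simp: T_convex_def)
  have ne: "T \<phi> x \<noteq> {}" for x
    using Cs by (auto simp: Cs_maps_def C_maps_def setvalued_maps_def)
  show ?thesis
  proof (rule finite_measure_mono_AE)
    show "AE x in \<omega>. x \<in> sv_preimage (T ?m) {y} \<longrightarrow> x \<in> sv_preimage (T \<phi>) {y}"
      using AE_Cs_maps_unique[OF Cs(2)]
    proof eventually_elim
      case (elim x)
      show ?case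
      proof
        assume "x \<in> sv_preimage (T ?m) {y}"
        then have y: "y \<in> T ?m x"
          by (simp add: sv_preimage_def)
        have "\<not> \<phi> x \<le> \<psi> x"
        proof
          assume "\<phi> x \<le> \<psi> x"
          then have "T \<psi> x \<subseteq> T ?m x"
            by (intro T_convex_image_subset[OF T \<psi> m]) auto
          then show False
            using q(1)[of x] q(2) elim y by blast
        qed
        then have "T \<phi> x \<subseteq> T ?m x"
          by (intro T_convex_image_subset[OF T \<phi> m]) auto
        moreover obtain z where z: "z \<in> T \<phi> x"
          using ne[of x] by blast
        ultimately have "z = y"
          using elim y by (auto dest: bspec)
        with z show "x \<in> sv_preimage (T \<phi>) {y}"
          by (simp add: sv_preimage_def)
      qed
    qed
    show "sv_preimage (T \<phi>) {y} \<in> sets \<omega>"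
      by (intro sv_preimage_borel[OF \<omega> Cs(1)]) simp
  qed
qed

text \<open>
  Otherwise one could select points of \<open>C\<close> in \<open>T (f n) x\<close> along a subsequence, and continuity of \<open>T\<close>
  would provide a limit point of them in \<open>T \<phi> x\<close>, which lies in \<open>C\<close> as well.
\<close>

lemma operator_continuous_eventually_disjoint:
  assumes T: "operator_continuous_at \<F> T \<phi>" and f: "\<And>n::nat. f n \<in> \<F>"
    and lim: "uniform_limit UNIV f \<phi> sequentially"
    and C: "closed C" "T \<phi> x \<inter> C = {}"
  shows "\<forall>\<^sub>F n in sequentially. T (f n) x \<inter> C = {}"
proof (rule ccontr)
  assume "\<not> ?thesis"
  then obtain r :: "nat \<Rightarrow> nat" where r: "strict_mono r" "\<And>n. T (f (r n)) x \<inter> C \<noteq> {}"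
    using not_eventually_sequentiallyD by blast
  then have "\<forall>n. \<exists>z. z \<in> T (f (r n)) x \<and> z \<in> C"
    by blast
  then obtain y where y: "\<And>n. y n \<in> T (f (r n)) x" "\<And>n. y n \<in> C"
    by metis
  have "uniform_limit UNIV (\<lambda>n. f (r n)) \<phi> sequentially"
    using lim filterlim_subseq[OF r(1)] by (rule filterlim_compose)
  then obtain s y0 where s: "y0 \<in> T \<phi> x" "(y \<circ> s) \<longlonglongrightarrow> y0"
    using T[unfolded operator_continuous_at_def, rule_format, of "\<lambda>n. f (r n)" y x] f y(1)
    by blast
  have "y0 \<in> C"
    using closed_sequentially[OF C(1) _ s(2)] y(2) by simp
  with s(1) C(2) show False
    by blast
qed

text \<open>
  At almost every \<open>x\<close> the indicators converge: if \<open>T \<phi> x\<close> misses \<open>q\<close>, so do eventually the sets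
  \<open>T (f n) x\<close>; if \<open>T \<phi> x = {q}\<close>, these sets eventually avoid the closed set \<open>S - {q}\<close>, but they
  meet \<open>S\<close> and so contain \<open>q\<close>. Dominated convergence does the rest.
\<close>

lemma measure_preimage_tendsto:
  assumes \<omega>: "radon_measure \<omega>" and T: "T_convex \<omega> \<F> T"
    and f: "\<And>n::nat. f n \<in> \<F>" and \<phi>: "\<phi> \<in> \<F>"
    and lim: "uniform_limit UNIV f \<phi> sequentially"
    and S: "finite S" "\<And>n x. T (f n) x \<inter> S \<noteq> {}"
  shows "(\<lambda>n. measure \<omega> (sv_preimage (T (f n)) {q}))
           \<longlonglongrightarrow> measure \<omega> (sv_preimage (T \<phi>) {q})"
proof -
  interpret finite_measure \<omega> using radon_measure_facts[OF \<omega>] by simp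
  have Cs: "T \<psi> \<in> Cs_maps \<omega>" if "\<psi> \<in> \<F>" for \<psi>
    using T that by (auto simp: T_convex_def)
  have meas: "sv_preimage (T \<psi>) {q} \<in> sets \<omega>" if "\<psi> \<in> \<F>" for \<psi>
    by (intro sv_preimage_borel[OF \<omega> Cs[OF that]]) simp
  have op: "operator_continuous_at \<F> T \<phi>"
    using T \<phi> by (simp add: T_convex_def)
  note disj = operator_continuous_eventually_disjoint[OF op f lim]
  have conv: "AE x in \<omega>. (\<lambda>n. indicat_real (sv_preimage (T (f n)) {q}) x)
                      \<longlonglongrightarrow> indicat_real (sv_preimage (T \<phi>) {q}) x"
    using AE_Cs_maps_unique[OF Cs[OF \<phi>]]
  proof eventually_elim
    case (elim x)
    have "\<forall>\<^sub>F n in sequentially. indicat_real (sv_preimage (T (f n)) {q}) x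
            = indicat_real (sv_preimage (T \<phi>) {q}) x"
    proof (cases "q \<in> T \<phi> x")
      case True
      then have "T \<phi> x \<inter> (S - {q}) = {}"
        using elim by auto
      then have "\<forall>\<^sub>F n in sequentially. T (f n) x \<inter> (S - {q}) = {}"
        using S(1) by (intro disj finite_imp_closed) auto
      then show ?thesis
      proof eventually_elim
        case (elim n)
        then have "q \<in> T (f n) x"
          using S(2)[of n x] by auto
        with True show ?case
          by (simp add: sv_preimage_def)
      qed
    next
      case False
      then have "\<forall>\<^sub>F n in sequentially. T (f n) x \<inter> {q} = {}"
        by (intro disj) auto
      then show ?thesis
        by eventually_elim (use False in \<open>auto simp: sv_preimage_def\<close>)
    qed
    then show ?case
      by (rule tendsto_eventually)
  qed
  have "(\<lambda>n. \<integral>x. indicat_real (sv_preimage (T (f n)) {q}) x \<partial>\<omega>)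
          \<longlonglongrightarrow> (\<integral>x. indicat_real (sv_preimage (T \<phi>) {q}) x \<partial>\<omega>)"
    using conv meas f \<phi>
    by (intro integral_dominated_convergence[where w = "\<lambda>_. 1"]) (auto simp: indicator_def)
  then show ?thesis
    using meas f \<phi> radon_measure_facts(2)[OF \<omega>] by simp
qed

text \<open>
  The supremum in the continuity property of \<open>h\<close> really bounds the pointwise differences: they are
  continuous functions on a compact space, so their range is bounded. That property says nothing
  about indices with \<open>s n = t\<close>, but there the difference is zero.
\<close>

lemma A3_uniform_limit:
  fixes h :: "real \<Rightarrow> 'b::metric_space \<Rightarrow> 'a::metric_space \<Rightarrow> real"
  assumes X: "compact (UNIV :: 'a set)" and T: "T_convex \<omega> \<F> T" and A3: "property_A3 \<F> T \<alpha> \<beta> h"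
    and t: "t \<in> ereal_interval (\<alpha> y) (\<beta> y)"
    and s: "(s \<longlongrightarrow> t) F" "\<And>n. s n \<in> ereal_interval (\<alpha> y) (\<beta> y)"
  shows "uniform_limit UNIV (\<lambda>n. h (s n) y) (h t y) F"
proof (rule uniform_limitI)
  fix e :: real assume e: "e > 0"
  let ?d = "\<lambda>t'. SUP x. \<bar>h t' y x - h t y x\<bar>"
  have hcont: "continuous_on UNIV (h t' y)" if "t' \<in> ereal_interval (\<alpha> y) (\<beta> y)" for t'
  proof -
    have "h t' y \<in> C_plus"
      using A3 T that unfolding property_A3_def T_convex_def by blast
    then show ?thesis
      by (simp add: C_plus_def)
  qed
  have "(?d \<longlongrightarrow> 0) (at t)"
    using A3 t unfolding property_A3_def by blast
  then have "\<forall>\<^sub>F t' in at t. ?d t' < e"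
    using e by (rule order_tendstoD)
  then have "\<forall>\<^sub>F t' in nhds t. t' \<noteq> t \<longrightarrow> ?d t' < e"
    by (simp add: eventually_at_filter)
  then have "\<forall>\<^sub>F n in F. s n \<noteq> t \<longrightarrow> ?d (s n) < e"
    by (rule eventually_compose_filterlim[OF _ s(1)])
  then show "\<forall>\<^sub>F n in F. \<forall>x\<in>UNIV. dist (h (s n) y x) (h t y x) < e"
  proof eventually_elim
    case (elim n)
    show ?case
    proof (cases "s n = t")
      case False
      have "compact (range (\<lambda>x. \<bar>h (s n) y x - h t y x\<bar>))"
        by (intro compact_continuous_image continuous_intros hcont t s X)
      then have "bdd_above (range (\<lambda>x. \<bar>h (s n) y x - h t y x\<bar>))"
        by (intro bounded_imp_bdd_above compact_imp_bounded)
      then have "\<bar>h (s n) y x - h t y x\<bar> \<le> ?d (s n)" for x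
        by (rule cSUP_upper[OF UNIV_I])
      with False elim show ?thesis
        by (auto simp: dist_real_def intro: le_less_trans)
    qed (use e in simp)
  qed
qed

lemma A3_eventually_small:
  assumes A3: "property_A3 \<F> T \<alpha> \<beta> h" and e: "e > 0"
  obtains t where "t \<in> ereal_interval (\<alpha> y) (\<beta> y)" "\<And>x. h t y x < e"
proof -
  have "\<alpha> y < \<beta> y" and "uniform_limit UNIV (\<lambda>t. h t y) (\<lambda>_. 0) (filtercomap ereal (at_left (\<beta> y)))"
    using A3 unfolding property_A3_def by blast+
  note ab = this(1) and lim = uniform_limitD[OF this(2) e]
  from lim obtain Q where Q: "eventually Q (at_left (\<beta> y))"
      "\<And>t x. Q (ereal t) \<Longrightarrow> \<bar>h t y x\<bar> < e"
    unfolding eventually_filtercomap by auto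
  from Q(1) obtain b where b: "b < \<beta> y" "\<And>z. b < z \<Longrightarrow> z < \<beta> y \<Longrightarrow> Q z"
    unfolding eventually_at_left[OF ab] by auto
  from ab b(1) have "max (\<alpha> y) b < \<beta> y"
    by simp
  then obtain t where "max (\<alpha> y) b < ereal t" "ereal t < \<beta> y"
    using ereal_dense2 by blast
  then show thesis
    using that[of t] b(2)[of "ereal t"] Q(2)[of t] by (auto simp: ereal_interval_def abs_less_iff)
qed

section \<open>Prescribing the masses\<close>

theorem theorem2p9:
  fixes \<omega> :: "'a::metric_space measure"
    and N :: nat
    and p :: "nat \<Rightarrow> 'b::metric_space"
    and g :: "nat \<Rightarrow> real"
    and \<F> :: "('a \<Rightarrow> real) set"
    and T :: "('a \<Rightarrow> real) \<Rightarrow> 'a \<Rightarrow> 'b set"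
    and \<alpha> \<beta> :: "'b \<Rightarrow> ereal"
    and h :: "real \<Rightarrow> 'b \<Rightarrow> 'a \<Rightarrow> real"
    and b0 :: "nat \<Rightarrow> real"
  assumes "compact (UNIV :: 'a set)"
    and "compact (UNIV :: 'b set)"
    and "radon_measure \<omega>"
    and "N \<ge> 2"
    and "inj_on p {1..N}"
    and "\<And>i. i \<in> {1..N} \<Longrightarrow> g i > 0"
    and "T_convex \<omega> \<F> T"
    and "property_A3 \<F> T \<alpha> \<beta> h"
    and "measure \<omega> UNIV = (\<Sum>i=1..N. g i)"
    and "\<And>i. i \<in> {1..N} \<Longrightarrow> b0 i \<in> ereal_interval (\<alpha> (p i)) (\<beta> (p i))"
    and "\<And>x. h (b0 1) (p 1) x \<le> (MIN i\<in>{2..N}. h (b0 i) (p i) x)"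
  shows "\<exists>b :: nat \<Rightarrow> real.
           b 1 = b0 1 \<and>
           (\<forall>i\<in>{2..N}. b i \<in> ereal_interval (\<alpha> (p i)) (\<beta> (p i))) \<and>
           induced_measure \<omega> (T (\<lambda>x. MAX i\<in>{1..N}. h (b i) (p i) x)) = dirac_sum {1..N} g p"
proof -
  note X = assms(1) and \<omega> = assms(3) and N = assms(4) and inj = assms(5) and gpos = assms(6)
    and T = assms(7) and A3 = assms(8) and total = assms(9) and b0 = assms(10)
  define I J where "I = {1..N}" and "J = {2..N}"
  have IJ: "finite I" "finite J" "I \<noteq> {}" "J \<subseteq> I" "I = insert 1 J" "1 \<notin> J" "1 \<in> I"
    using N by (auto simp: I_def J_def)
  have injI: "inj_on p I" and injJ: "inj_on p J"
    using inj IJ by (auto simp: I_def intro: inj_on_subset)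
  define adm where "adm = (\<lambda>i. ereal_interval (\<alpha> (p i)) (\<beta> (p i)))"
  define H where "H = (\<lambda>i t. h t (p i))"
  define \<rho> where "\<rho> = (\<lambda>b x. MAX i\<in>I. H i (b i) x)"
  define G where "G = (\<lambda>b i. measure \<omega> (sv_preimage (T (\<rho> b)) {p i}))"
  have HF: "H i t \<in> \<F>" and pH: "p i \<in> T (H i t) x" if "t \<in> adm i" for i t x
    using A3 that by (auto simp: property_A3_def adm_def H_def)
  have Hanti: "H i t x \<le> H i s x" if "s \<in> adm i" "t \<in> adm i" "s \<le> t" for i s t x
    using A3 that by (auto simp: property_A3_def adm_def H_def)
  have H1: "H 1 (b0 1) x \<le> H i (b0 i) x" if "i \<in> J" for i x
  proof -
    have "h (b0 1) (p 1) x \<le> (MIN i\<in>J. h (b0 i) (p i) x)"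
      using assms(11) by (simp add: J_def)
    also have "\<dots> \<le> h (b0 i) (p i) x"
      using that IJ by (intro Min_le) auto
    finally show ?thesis by (simp add: H_def)
  qed
  have b0_adm: "b0 i \<in> adm i" if "i \<in> I" for i
    using b0 that by (simp add: I_def adm_def)

  have \<rho>F: "\<rho> b \<in> \<F>" if "\<And>i. i \<in> I \<Longrightarrow> b i \<in> adm i" for b
    unfolding \<rho>_def using IJ that by (intro T_convex_Max_closed[OF T] HF)
  have Cs: "T \<phi> \<in> Cs_maps \<omega>" if "\<phi> \<in> \<F>" for \<phi>
    using T that by (simp add: T_convex_def)
  have H_le: "H i (b i) x \<le> \<rho> b x" if "i \<in> I" for i b x
    unfolding \<rho>_def using that IJ by (intro Max_ge) auto
  have attained: "\<exists>i\<in>I. H i (b i) x = \<rho> b x" for b x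
    unfolding \<rho>_def using Max_in[of "(\<lambda>i. H i (b i) x) ` I"] IJ by auto
  have hit: "p i \<in> T (\<rho> b) x"
    if "\<And>i. i \<in> I \<Longrightarrow> b i \<in> adm i" "i \<in> I" "H i (b i) x = \<rho> b x" for i b x
    using T_convex_image_subset[OF T HF \<rho>F, of "b i" i b x] pH H_le that by blast
  have mass: "sum (G b) K = measure \<omega> UNIV"
    if adm: "\<And>i. i \<in> I \<Longrightarrow> b i \<in> adm i" and K: "K \<subseteq> I" "\<And>x. \<exists>i\<in>K. H i (b i) x = \<rho> b x" for b K
    unfolding G_def
  proof (rule sum_measure_preimage[OF \<omega> Cs[OF \<rho>F[OF adm]]])
    show "finite K" "inj_on p K"
      using finite_subset[OF K(1) IJ(1)] inj_on_subset[OF injI K(1)] by simp_all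
    show "\<exists>i\<in>K. p i \<in> T (\<rho> b) x" for x
      using K hit[OF adm] by blast
  qed

  \<comment> \<open>The upper corner \<open>c\<close> of the box makes \<open>H i\<close> for \<open>i \<in> J\<close> smaller than the positive lower bound
     of \<open>H 1 (b0 1)\<close> given by compactness. It agrees with \<open>b0\<close> off \<open>J\<close>, which fixes \<open>b 1 = b0 1\<close>.\<close>
  have "continuous_on UNIV (H 1 (b0 1))" "\<And>x. H 1 (b0 1) x > 0"
    using HF[OF b0_adm[of 1]] T IJ by (auto simp: T_convex_def C_plus_def)
  then obtain e where e: "e > 0" "\<And>x. e \<le> H 1 (b0 1) x"
    using continuous_attains_inf[OF X] by (metis UNIV_I UNIV_not_empty)
  have "\<forall>i. \<exists>t. t \<in> adm i \<and> (\<forall>x. H i t x < e)"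
    unfolding adm_def H_def using A3_eventually_small[OF A3 e(1)] by metis
  then obtain \<tau> where \<tau>: "\<And>i. \<tau> i \<in> adm i" "\<And>i x. H i (\<tau> i) x < e"
    by metis
  define c where "c = (\<lambda>i. if i \<in> J then \<tau> i else b0 i)"
  have b0_le_c: "b0 i \<le> c i" for i
  proof (cases "i \<in> J")
    case True
    have "\<not> \<tau> i \<le> b0 i"
    proof
      assume "\<tau> i \<le> b0 i"
      then have "H i (b0 i) x \<le> H i (\<tau> i) x" for x
        using Hanti \<tau> b0_adm True IJ by blast
      then show False
        using H1[OF True] e(2) \<tau>(2)[of i] by (meson le_less_trans order_trans not_less)
    qed
    then show ?thesis
      using True by (simp add: c_def)
  qed (simp add: c_def)
  have c_adm: "c i \<in> adm i" if "i \<in> I" for i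
    using that \<tau> b0_adm by (simp add: c_def)
  have "H 1 (c 1) x = \<rho> c x" for x
  proof -
    have "H i (c i) x \<le> H 1 (c 1) x" if "i \<in> I" for i
      using that IJ e(2)[of x] \<tau>(2)[of i x] by (auto simp: c_def)
    then show ?thesis
      using attained[of c x] H_le[of 1 c x] IJ by (metis order_antisym)
  qed
  then have "sum (G c) {1} = measure \<omega> UNIV" "sum (G c) I = measure \<omega> UNIV"
    using IJ attained by (intro mass c_adm; auto)+
  then have "sum (G c) J = 0"
    using IJ by simp
  then have Gc: "G c i = 0" if "i \<in> J" for i
    using that IJ sum_nonneg_eq_0_iff[of J "G c"] by (simp add: G_def)

  define B where "B = {b. \<forall>i. b0 i \<le> b i \<and> b i \<le> c i}"
  have B_adm: "b i \<in> adm i" if "b \<in> B" "i \<in> I" for b i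
  proof -
    have "b0 i \<in> adm i" "c i \<in> adm i" "b0 i \<le> b i" "b i \<le> c i"
      using b0_adm c_adm that by (auto simp: B_def)
    then show ?thesis
      using less_le_trans[of "\<alpha> (p i)" "b0 i" "b i"] le_less_trans[of "b i" "c i" "\<beta> (p i)"]
      by (simp add: adm_def ereal_interval_def)
  qed
  have \<rho>_B: "\<rho> b \<in> \<F>" if "b \<in> B" for b
    by (intro \<rho>F B_adm that)
  have hit_B: "\<exists>i\<in>I. p i \<in> T (\<rho> b) x" if "b \<in> B" for b x
    using attained[of b x] hit[OF B_adm[OF that]] by blast
  have B_1: "b 1 = b0 1" if "b \<in> B" for b
  proof -
    have "c 1 = b0 1"
      using IJ by (simp add: c_def)
    moreover have "b0 1 \<le> b 1" "b 1 \<le> c 1"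
      using that unfolding B_def by blast+
    ultimately show ?thesis
      by simp
  qed

  have contG: "continuous_on B (\<lambda>b. G b i)" for i
    unfolding continuous_on_sequentially
  proof (intro allI ballI impI, elim conjE)
    fix u b assume u: "\<forall>n. u n \<in> B" and b: "b \<in> B" and lim: "u \<longlonglongrightarrow> b"
    have "uniform_limit UNIV (\<lambda>n. H k (u n k)) (H k (b k)) sequentially" if "k \<in> I" for k
      unfolding H_def
    proof (rule A3_uniform_limit[OF X T A3])
      show "b k \<in> ereal_interval (\<alpha> (p k)) (\<beta> (p k))"
        using B_adm[OF b that] by (simp add: adm_def)
      show "u n k \<in> ereal_interval (\<alpha> (p k)) (\<beta> (p k))" for n
        using B_adm[OF u[rule_format] that] by (simp add: adm_def)
      show "(\<lambda>n. u n k) \<longlonglongrightarrow> b k"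
        by (rule continuous_on_tendsto_compose[OF continuous_on_product_coordinates lim]) simp_all
    qed
    then have "uniform_limit UNIV (\<lambda>n. \<rho> (u n)) (\<rho> b) sequentially"
      unfolding \<rho>_def by (intro uniform_limit_Max IJ)
    moreover have "T (\<rho> (u n)) x \<inter> p ` I \<noteq> {}" for n x
      using hit_B u by blast
    ultimately show "((\<lambda>b. G b i) \<circ> u) \<longlonglongrightarrow> G b i"
      unfolding G_def o_def
      by (intro measure_preimage_tendsto[OF \<omega> T, where S = "p ` I"] \<rho>_B b u[rule_format]
          finite_imageI IJ(1))
  qed

  have monoG: "G (b(k := t)) i \<le> G b i"
    if b: "b \<in> B" and k: "k \<in> J" and i: "i \<in> J" "i \<noteq> k" and t: "b0 k \<le> t" "t \<le> b k" for b k i t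
  proof -
    have bt: "b(k := t) \<in> B"
      using b t unfolding B_def by (auto intro: order_trans)
    have kI: "k \<in> I" using k IJ by auto
    have tk: "t \<in> adm k"
      using B_adm[OF bt kI] by simp
    have "\<rho> (b(k := t)) x = max (\<rho> b x) (H k t x)" for x
    proof (rule antisym)
      obtain j where j: "j \<in> I" "H j ((b(k := t)) j) x = \<rho> (b(k := t)) x"
        using attained[of "b(k := t)" x] by blast
      show "\<rho> (b(k := t)) x \<le> max (\<rho> b x) (H k t x)"
        using j H_le[OF j(1), of b x] by (cases "j = k") auto
      obtain j where j: "j \<in> I" "H j (b j) x = \<rho> b x"
        using attained[of b x] by blast
      have "H j (b j) x \<le> \<rho> (b(k := t)) x"
        using H_le[OF j(1), of "b(k := t)" x] Hanti[OF tk B_adm[OF b kI] t(2), of x]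
        by (cases "j = k") auto
      then show "max (\<rho> b x) (H k t x) \<le> \<rho> (b(k := t)) x"
        using j H_le[OF kI, of "b(k := t)" x] by simp
    qed
    then have max: "\<rho> (b(k := t)) = (\<lambda>x. max (\<rho> b x) (H k t x))"
      by (rule ext)
    show ?thesis
      unfolding G_def max
    proof (rule measure_preimage_max_le[OF \<omega> T \<rho>_B[OF b] HF[OF tk]])
      show "p k \<in> T (H k t) x" for x
        using pH[OF tk] .
      show "p i \<noteq> p k"
        using injJ i k by (auto dest: inj_onD)
    qed
  qed

  have interior: "b i \<noteq> b0 i"
    if b: "b \<in> B" and le: "\<And>j. j \<in> J \<Longrightarrow> G b j \<le> g j" and i: "i \<in> J" for b i
  proof
    assume bi: "b i = b0 i"
    have cover: "\<exists>j\<in>J. H j (b j) x = \<rho> b x" for x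
    proof -
      obtain j where j: "j \<in> I" "H j (b j) x = \<rho> b x"
        using attained[of b x] by blast
      \<comment> \<open>If the first function attains the maximum, so does the \<open>i\<close>-th, which dominates it.\<close>
      have "H i (b i) x = \<rho> b x" if "j = 1"
      proof (rule antisym)
        show "H i (b i) x \<le> \<rho> b x"
          using i IJ(4) by (intro H_le) blast
        show "\<rho> b x \<le> H i (b i) x"
          using j(2) that H1[OF i, of x] bi B_1[OF b] by simp
      qed
      then show ?thesis
        using j i IJ by blast
    qed
    have "measure \<omega> UNIV = sum (G b) J"
      by (rule mass[OF B_adm[OF b] IJ(4) cover, symmetric])
    also have "\<dots> \<le> sum g J"
      using le by (rule sum_mono)
    also have "\<dots> < sum g I"
      using IJ gpos[of 1] N by simp
    finally show False
      using total by (simp add: I_def)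
  qed

  obtain b where b: "b \<in> B" "\<And>i. i \<in> J \<Longrightarrow> G b i = g i"
  proof (rule antitone_system_solution[of J b0 c G g])
    show "G c i \<le> g i" if "i \<in> J" for i
      using Gc[OF that] gpos[of i] that IJ by (simp add: I_def less_imp_le subset_iff)
  qed (use IJ contG monoG interior b0_le_c in \<open>auto simp: B_def\<close>)
  have "sum (G b) I = sum g I"
    using mass[OF B_adm[OF b(1)], of I] attained total by (simp add: I_def)
  moreover have "sum (G b) J = sum g J"
    by (intro sum.cong refl b(2))
  ultimately have "G b 1 = g 1"
    using IJ by simp
  then have Gb: "G b i = g i" if "i \<in> I" for i
    using that b(2)[of i] IJ(5) by blast
  have "induced_measure \<omega> (T (\<rho> b)) = dirac_sum I (G b) p"
    unfolding G_def
    by (intro induced_measure_eq_dirac_sum \<omega> Cs \<rho>_B hit_B b(1) IJ(1) injI)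
  also have "\<dots> = dirac_sum I g p"
    by (simp add: dirac_sum_def Gb cong: sum.cong)
  finally have "induced_measure \<omega> (T (\<lambda>x. MAX i\<in>{1..N}. h (b i) (p i) x)) = dirac_sum {1..N} g p"
    by (simp add: \<rho>_def H_def I_def)
  moreover have "\<forall>i\<in>{2..N}. b i \<in> ereal_interval (\<alpha> (p i)) (\<beta> (p i))"
    using B_adm[OF b(1)] by (simp add: adm_def I_def)
  ultimately show ?thesis
    using B_1[OF b(1)] by blast
qed

end
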